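(* For every integer $m\ge 0$, the ratio $R_{m+1}(x)=\frac{V_{m+1}(x)}{V_m(x)}$ is increasing in $x$ on $(0,\infty)$.
   Context: For real $m>-1$ and $x>0$, $V_m(x)=\frac{2e^{x^2}}{\Gamma(m+1)}\int_x^\infty (t^2-x^2)^m e^{-t^2}\,dt=\frac{1}{\Gamma(m+1)}\int_0^\infty \frac{u^m e^{-u}}{\sqrt{x^2+u}}\,du$. In the paper $\mathbf{N}$ includes $0$. *)

theory Defs
  imports "HOL-Analysis.Analysis"
begin

text \<open>
  Meant for \<open>m > -1\<close> and \<open>x > 0\<close>, where the integrand is Lebesgue integrable on
  \<open>(x, \<infinity>)\<close>.  On this open interval \<open>t\<^sup>2 - x\<^sup>2 > 0\<close>, so \<open>powr\<close> is the usual real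
  power; in particular it is constantly \<open>1\<close> for \<open>m = 0\<close>.
\<close>

definition V :: "real \<Rightarrow> real \<Rightarrow> real" where
  "V m x = 2 * exp (x\<^sup>2) / Gamma (m + 1) *
     (LBINT t:{x<..}. (t\<^sup>2 - x\<^sup>2) powr m * exp (- (t\<^sup>2)))"

end

theory Submission
  imports Defs
begin

text \<open>
  The substitution \<open>u = t\<^sup>2 - x\<^sup>2\<close> turns \<open>V m x\<close> into
  \<open>1 / Gamma (m + 1)\<close> times the total mass of the weight
  \<open>w\<^sub>x(u) = u powr m * exp (- u) / sqrt (x\<^sup>2 + u)\<close> on the half-line \<open>u > 0\<close>
  (lemma \<open>V_eq_integral_over_half_line\<close>).  Since raising \<open>m\<close> by one multiplies the weight
  by \<open>u\<close>, the ratio \<open>V (m + 1) x / V m x\<close> is, up to a positive constant depending only on \<open>m\<close>,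
  the mean of \<open>u\<close> under the probability density proportional to \<open>w\<^sub>x\<close>.

  For \<open>x < y\<close> the likelihood ratio
  \<open>w\<^sub>y(u) / w\<^sub>x(u) = sqrt (x\<^sup>2 + u) / sqrt (y\<^sup>2 + u)\<close> is strictly increasing in \<open>u\<close>:
  passing from \<open>x\<close> to \<open>y\<close> shifts mass to the right, so the mean grows
  (lemma \<open>mean_less_reweighted_mean\<close>).
\<close>

lemma set_integral_pos:
  fixes f :: "'a \<Rightarrow> real"
  assumes f: "set_integrable M A f"
    and A: "A \<in> sets M" "A \<notin> null_sets M"
    and pos: "AE x\<in>A in M. f x > 0"
  shows "(LINT x:A|M. f x) > 0"
proof -
  have nonneg: "AE x in M. 0 \<le> indicator A x *\<^sub>R f x"
    using pos by eventually_elim (auto simp: indicator_def)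
  have "(LINT x:A|M. f x) \<noteq> 0"
  proof
    assume "(LINT x:A|M. f x) = 0"
    hence "AE x in M. indicator A x *\<^sub>R f x = 0"
      using integral_nonneg_eq_0_iff_AE[OF _ nonneg] f
      unfolding set_lebesgue_integral_def set_integrable_def by blast
    hence "AE x in M. x \<notin> A"
      using pos by eventually_elim (auto simp: indicator_def)
    thus False
      using A by (simp add: AE_iff_null_sets)
  qed
  moreover have "(LINT x:A|M. f x) \<ge> 0"
    unfolding set_lebesgue_integral_def by (rule integral_nonneg_AE[OF nonneg])
  ultimately show ?thesis by simp
qed

lemma half_line_not_null: "{0::real<..} \<notin> null_sets lborel"
proof
  assume "{0::real<..} \<in> null_sets lborel"
  hence "{0::real<..<1} \<in> null_sets lborel"
    by (rule null_sets_subset) auto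
  thus False by (auto simp: null_sets_def)
qed

text \<open>
  Monotone likelihood ratio: with \<open>c\<close> the mean of \<open>u\<close> under \<open>w\<close>, both factors of
  \<open>(u - c) * (h u - h c)\<close> have the same sign, so this product has a positive integral against
  \<open>w\<close>.  The term with \<open>h c\<close> drops out by the choice of \<open>c\<close>, and what remains says that
  \<open>u - c\<close> has a positive integral against \<open>h * w\<close>, that is, the mean under \<open>h * w\<close> exceeds \<open>c\<close>.
\<close>

lemma mean_less_reweighted_mean:
  fixes w h :: "real \<Rightarrow> real"
  assumes w: "set_integrable lborel {0<..} w" "set_integrable lborel {0<..} (\<lambda>u. u * w u)"
    and hw: "set_integrable lborel {0<..} (\<lambda>u. h u * w u)"
      "set_integrable lborel {0<..} (\<lambda>u. u * (h u * w u))"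
    and w_pos: "\<And>u. u > 0 \<Longrightarrow> w u > 0" and h_pos: "\<And>u. u > 0 \<Longrightarrow> h u > 0"
    and h: "strict_mono_on {0<..} h"
  shows "(LBINT u:{0<..}. u * w u) / (LBINT u:{0<..}. w u)
       < (LBINT u:{0<..}. u * (h u * w u)) / (LBINT u:{0<..}. h u * w u)"
proof -
  define c where "c = (LBINT u:{0<..}. u * w u) / (LBINT u:{0<..}. w u)"
  have W: "(LBINT u:{0<..}. w u) > 0" and HW: "(LBINT u:{0<..}. h u * w u) > 0"
    and UW: "(LBINT u:{0<..}. u * w u) > 0"
    by (intro set_integral_pos half_line_not_null w hw AE_I2; simp add: w_pos h_pos)+
  \<comment> \<open>The comparison of \<open>h u\<close> with \<open>h c\<close> needs \<open>c\<close> to lie in the domain of monotonicity.\<close>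
  have c: "c > 0" unfolding c_def using W UW by simp
  have pos: "(u - c) * (h u - h c) * w u > 0" if "u > 0" "u \<noteq> c" for u
  proof (cases "u < c")
    case True
    hence "h u < h c" using h c that by (auto simp: strict_mono_on_def)
    thus ?thesis using True w_pos that by (simp add: mult_neg_neg)
  next
    case False
    hence "h c < h u" using h c that by (auto simp: strict_mono_on_def)
    thus ?thesis using False w_pos that by simp
  qed
  have split: "(u - c) * (h u - h c) * w u
      = (u * (h u * w u) - c * (h u * w u)) - h c * (u * w u - c * w u)" for u
    by (simp add: algebra_simps)
  have ae: "AE u\<in>{0<..} in lborel. (u - c) * (h u - h c) * w u > 0"
    using AE_lborel_singleton[of c] by eventually_elim (auto intro: pos)
  have "0 < (LBINT u:{0<..}. (u - c) * (h u - h c) * w u)"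
    unfolding split
    by (intro set_integral_pos half_line_not_null set_integral_diff set_integrable_mult_right w hw)
      (use ae in \<open>auto simp: split\<close>)
  also have "\<dots> = ((LBINT u:{0<..}. u * (h u * w u)) - c * (LBINT u:{0<..}. h u * w u))
      - h c * ((LBINT u:{0<..}. u * w u) - c * (LBINT u:{0<..}. w u))"
    unfolding split using w hw by (simp add: set_integral_diff)
  also have "(LBINT u:{0<..}. u * w u) - c * (LBINT u:{0<..}. w u) = 0"
    using W by (simp add: c_def)
  finally show ?thesis
    using HW by (simp add: c_def[symmetric] pos_less_divide_eq)
qed

lemma set_integrable_Gamma:
  fixes m :: real
  assumes "m > -1"
  shows "set_integrable lborel {0<..} (\<lambda>u. u powr m * exp (- u))"
proof -
  have "((\<lambda>u. u powr m / exp u) has_integral Gamma (m + 1)) {0..}"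
    using Gamma_integral_real[of "m + 1"] assms by simp
  hence "(\<lambda>u. u powr m / exp u) absolutely_integrable_on {0..}"
    by (intro nonnegative_absolutely_integrable_1) (auto simp: has_integral_iff)
  hence "(\<lambda>u. u powr m / exp u) absolutely_integrable_on {0<..}"
    by (rule set_integrable_subset) auto
  hence "set_integrable lborel {0<..} (\<lambda>u. u powr m / exp u)"
    unfolding set_integrable_def by (subst (asm) integrable_completion) auto
  thus ?thesis
    by (simp add: exp_minus field_simps)
qed

text \<open>
  Bounding \<open>1 / sqrt (x\<^sup>2 + u)\<close> by \<open>1 / x\<close> reduces the claim to the Gamma integral.
\<close>

lemma set_integrable_V_weight:
  fixes m x :: real
  assumes "m > -1" "x > 0"
  shows "set_integrable lborel {0<..} (\<lambda>u. u powr m * exp (- u) / sqrt (x\<^sup>2 + u))"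
proof (rule set_integrable_bound)
  show "set_integrable lborel {0<..} (\<lambda>u. u powr m * exp (- u) / x)"
    using set_integrable_Gamma[of m] assms by simp
  show "set_borel_measurable lborel {0<..} (\<lambda>u. u powr m * exp (- u) / sqrt (x\<^sup>2 + u))"
    unfolding set_borel_measurable_def by measurable
  have "u powr m * exp (- u) / sqrt (x\<^sup>2 + u) \<le> u powr m * exp (- u) / x" if "u > 0" for u
    using assms that by (intro divide_left_mono real_le_rsqrt mult_pos_pos real_sqrt_gt_zero add_pos_pos) auto
  thus "AE u in lborel. u \<in> {0<..} \<longrightarrow> norm (u powr m * exp (- u) / sqrt (x\<^sup>2 + u))
      \<le> norm (u powr m * exp (- u) / x)"
    using assms by (intro AE_I2) auto
qed

text \<open>
  The substitution is carried out as \<open>t = sqrt (x\<^sup>2 + u)\<close>, pulling the integrand back to the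
  fixed half-line \<open>u > 0\<close>, because there its integrability has just been established.  The factor
  \<open>exp (- x\<^sup>2) / 2\<close> that appears cancels the normalisation \<open>2 * exp (x\<^sup>2)\<close> of \<open>V\<close>.
\<close>

lemma V_eq_integral_over_half_line:
  fixes m x :: real
  assumes m: "m > -1" and x: "x > 0"
  shows "V m x = (LBINT u:{0<..}. u powr m * exp (- u) / sqrt (x\<^sup>2 + u)) / Gamma (m + 1)"
proof -
  let ?w = "\<lambda>u. u powr m * exp (- u) / sqrt (x\<^sup>2 + u)"
  let ?f = "\<lambda>t. (t\<^sup>2 - x\<^sup>2) powr m * exp (- (t\<^sup>2))"
  let ?g = "\<lambda>u. sqrt (x\<^sup>2 + u)" and ?g' = "\<lambda>u. 1 / (2 * sqrt (x\<^sup>2 + u))"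
  have sq: "x\<^sup>2 + u > 0" if "u \<ge> 0" for u using x that by (simp add: add_pos_nonneg)
  have fg: "?f (?g u) * ?g' u = exp (- x\<^sup>2) / 2 * ?w u" if "u > 0" for u
    using sq[of u] that by (simp add: exp_add[symmetric] exp_diff exp_minus field_simps)
  have "(LBINT t=ereal x..\<infinity>. ?f t) = (LBINT u=0..\<infinity>. ?f (?g u) * ?g' u)"
  proof (rule interval_integral_substitution_nonneg(2))
    show "DERIV ?g u :> ?g' u" if "0 < ereal u" for u
      using sq[of u] that by (auto intro!: derivative_eq_intros simp: field_simps)
    show "isCont ?f (?g u)" if "0 < ereal u" for u
      using sq[of u] that by (intro continuous_intros) auto
    show "isCont ?g' u" if "0 < ereal u" for u
      using sq[of u] that by (intro continuous_intros) auto
    show "0 \<le> ?g' u" if "0 \<le> ereal u" for u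
      using sq[of u] that by auto
    show "((ereal \<circ> ?g \<circ> real_of_ereal) \<longlongrightarrow> ereal x) (at_right 0)"
    proof -
      have "((\<lambda>u. ?g u) \<longlongrightarrow> sqrt (x\<^sup>2 + 0)) (at_right 0)"
        by (intro tendsto_intros)
      thus ?thesis
        using x by (simp add: zero_ereal_def ereal_tendsto_simps)
    qed
    show "((ereal \<circ> ?g \<circ> real_of_ereal) \<longlongrightarrow> \<infinity>) (at_left \<infinity>)"
    proof -
      have "filterlim (\<lambda>u. ?g u) at_top at_top"
        by (rule filterlim_compose[OF sqrt_at_top
              filterlim_tendsto_add_at_top[OF tendsto_const filterlim_ident]])
      thus ?thesis
        by (simp add: ereal_tendsto_simps)
    qed
    show "set_integrable lborel (einterval 0 \<infinity>) (\<lambda>u. ?f (?g u) * ?g' u)"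
    proof -
      have "set_integrable lborel {0<..} (\<lambda>u. exp (- x\<^sup>2) / 2 * ?w u)"
        using set_integrable_V_weight[OF m x] by (rule set_integrable_mult_right)
      thus ?thesis
        unfolding zero_ereal_def einterval_eq
        by (subst set_integrable_cong[OF refl refl fg]) auto
    qed
  qed auto
  also have "\<dots> = (LBINT u:{0<..}. exp (- x\<^sup>2) / 2 * ?w u)"
    unfolding interval_lebesgue_integral_0_infty
    by (rule set_lebesgue_integral_cong) (use fg in auto)
  also have "\<dots> = exp (- x\<^sup>2) / 2 * (LBINT u:{0<..}. ?w u)"
    by (rule set_integral_mult_right)
  finally have "(LBINT t:{x<..}. ?f t) = exp (- x\<^sup>2) / 2 * (LBINT u:{0<..}. ?w u)"
    by (simp only: interval_integral_to_infinity_eq)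
  thus ?thesis
    unfolding V_def by (simp add: exp_minus field_simps)
qed

text \<open>
  This is the likelihood ratio of the weights for \<open>x\<close> and \<open>y\<close>, with \<open>a = x\<^sup>2\<close> and \<open>b = y\<^sup>2\<close>.
\<close>

lemma strict_mono_on_sqrt_ratio:
  fixes a b :: real
  assumes "0 < a" "a < b"
  shows "strict_mono_on {0<..} (\<lambda>u. sqrt (a + u) / sqrt (b + u))"
proof (rule strict_mono_onI)
  fix u v :: real assume uv: "u \<in> {0<..}" "v \<in> {0<..}" "u < v"
  have "(b - a) * u < (b - a) * v" using assms uv by simp
  hence "(a + u) / (b + u) < (a + v) / (b + v)"
    using assms uv by (simp add: divide_simps algebra_simps)
  thus "sqrt (a + u) / sqrt (b + u) < sqrt (a + v) / sqrt (b + v)"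
    by (simp flip: real_sqrt_divide)
qed

theorem V_ratio_strict_mono:
  fixes m :: real
  assumes m: "m > -1"
  shows "strict_mono_on {0<..} (\<lambda>x. V (m + 1) x / V m x)"
proof (rule strict_mono_onI)
  fix x y :: real assume xy: "x \<in> {0<..}" "y \<in> {0<..}" "x < y"
  define w where "w = (\<lambda>x u. u powr m * exp (- u) / sqrt (x\<^sup>2 + u))"
  define h where "h = (\<lambda>u. sqrt (x\<^sup>2 + u) / sqrt (y\<^sup>2 + u))"
  have shift: "u powr (m + 1) * exp (- u) / sqrt (z\<^sup>2 + u) = u * w z u" if "u \<in> {0<..}" for z u
    using that by (simp add: w_def powr_add)
  have int: "set_integrable lborel {0<..} (w z)"
    "set_integrable lborel {0<..} (\<lambda>u. u * w z u)" if "z > 0" for z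
  proof -
    show "set_integrable lborel {0<..} (w z)"
      unfolding w_def by (rule set_integrable_V_weight[OF m that])
    have "set_integrable lborel {0<..} (\<lambda>u. u powr (m + 1) * exp (- u) / sqrt (z\<^sup>2 + u))"
      using m that by (intro set_integrable_V_weight) auto
    also have "?this \<longleftrightarrow> set_integrable lborel {0<..} (\<lambda>u. u * w z u)"
      by (intro set_integrable_cong refl shift)
    finally show "set_integrable lborel {0<..} (\<lambda>u. u * w z u)" .
  qed
  have hw: "w y u = h u * w x u" if "u \<in> {0<..}" for u
    using that xy sum_power2_gt_zero_iff by (simp add: h_def w_def add_pos_pos less_imp_neq[symmetric])
  define C where "C = Gamma (m + 1) / Gamma (m + 2)"
  have C: "C > 0" using m by (simp add: C_def)
  have ratio: "V (m + 1) z / V m z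
      = C * ((LBINT u:{0<..}. u * w z u) / (LBINT u:{0<..}. w z u))" if "z > 0" for z
  proof -
    have "(LBINT u:{0<..}. u powr (m + 1) * exp (- u) / sqrt (z\<^sup>2 + u))
        = (LBINT u:{0<..}. u * w z u)"
      by (rule set_lebesgue_integral_cong) (use shift in auto)
    hence "V (m + 1) z = (LBINT u:{0<..}. u * w z u) / Gamma (m + 2)"
      using m that by (simp add: V_eq_integral_over_half_line add.assoc)
    moreover have "V m z = (LBINT u:{0<..}. w z u) / Gamma (m + 1)"
      using m that by (simp add: V_eq_integral_over_half_line w_def)
    ultimately show ?thesis
      by (simp add: C_def)
  qed
  have "x\<^sup>2 < y\<^sup>2" using xy by (intro power_strict_mono) auto
  have "(LBINT u:{0<..}. u * w x u) / (LBINT u:{0<..}. w x u)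
      < (LBINT u:{0<..}. u * (h u * w x u)) / (LBINT u:{0<..}. h u * w x u)"
  proof (rule mean_less_reweighted_mean)
    show "strict_mono_on {0<..} h"
      unfolding h_def using xy \<open>x\<^sup>2 < y\<^sup>2\<close> by (intro strict_mono_on_sqrt_ratio) auto
    have "set_integrable lborel {0<..} (\<lambda>u. h u * w x u) \<longleftrightarrow> set_integrable lborel {0<..} (w y)"
      "set_integrable lborel {0<..} (\<lambda>u. u * (h u * w x u))
        \<longleftrightarrow> set_integrable lborel {0<..} (\<lambda>u. u * w y u)"
      by (rule set_integrable_cong; simp add: hw)+
    thus "set_integrable lborel {0<..} (\<lambda>u. h u * w x u)"
      "set_integrable lborel {0<..} (\<lambda>u. u * (h u * w x u))"
      using int[of y] xy by auto
  qed (use xy int in \<open>auto simp: w_def h_def add_pos_pos\<close>)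
  also have "\<dots> = (LBINT u:{0<..}. u * w y u) / (LBINT u:{0<..}. w y u)"
    by (intro arg_cong2[where f = "(/)"] set_lebesgue_integral_cong) (auto simp: hw)
  finally show "V (m + 1) x / V m x < V (m + 1) y / V m y"
    using xy C mult_strict_left_mono[of _ _ C] by (simp add: ratio del: times_divide_eq_right)
qed

theorem theorem22:
  fixes m :: nat
  shows "strict_mono_on {0<..} (\<lambda>x. V (real m + 1) x / V (real m) x)"
  by (rule V_ratio_strict_mono) simp

end
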